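(* Let a point-free relation algebra satisfy the axiom of choice (every per has an index). Then a relation $S$ is minimal with respect to the thins ordering $\preceq$ on arbitrary relations (of the type of $S$) if and only if $S$ is a core relation.
   Context: A point-free relation algebra consists of the following. There is a non-empty set of basic types; each element (relation) $X$ has a type $A\sim B$ for basic types $A,B$. Monoid structure: for $X$ of type $A\sim B$ and $Y$ of type $B\sim C$ there is a composition $X\circ Y$ of type $A\sim C$; composition is associative, and for each basic type $A$ there is an identity $\mathbb{I}$ of type $A\sim A$ which is a unit of composition. Lattice structure: the relations of each type $A\sim B$ form a (finitely) distributive lattice ordered by $\subseteq$ with join $\cup$, meet $\cap$, least element $\bot$ and greatest element $\top$ (types of $\mathbb{I},\bot,\top$ are deduced from context). Factors: there are operators $\setminus$ and $/$ with $(Y\subseteq X\setminus Z)\equiv (X\circ Y\subseteq Z)\equiv (X\subseteq Z/Y)$. Converse: for each $X$ of type $A\sim B$ there is $X^{\smile}$ of type $B\sim A$, with $X^{\smile}\subseteq Y\equiv X\subseteq Y^{\smile}$, $\mathbb{I}^{\smile}=\mathbb{I}$, $(X\circ Y)^{\smile}=Y^{\smile}\circ X^{\smile}$. Modularity law: $X\circ Y\cap Z\subseteq X\circ(Y\cap X^{\smile}\circ Z)$. Complements and the cone rule ($\top\circ X\circ\top=\top\equiv X\neq\bot$) are not assumed. A per is a relation $P$ (of some type $A\sim A$) with $P=P^{\smile}$ and $P\circ P\subseteq P$. For a per $P$, $\mathrm{dom}(P)=\mathbb{I}\cap P$ is its (left and right) domain. An index of a per $P$ is a relation $J$ with (a)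 $J\subseteq \mathrm{dom}(P)$, (b) $J\circ P\circ J=J$, (c) $P\circ J\circ P=P$. The axiom of choice is the statement: every per has an index. For an arbitrary relation $R$: the left domain is $\mathrm{ldom}(R)=\mathbb{I}\cap R\circ R^{\smile}$ and the right domain is $\mathrm{rdom}(R)=\mathbb{I}\cap R^{\smile}\circ R$. The left per-domain is $\mathrm{lper}(R)=\mathrm{ldom}(R)\circ\big((R/R)\cap (R/R)^{\smile}\big)$ and the right per-domain is $\mathrm{rper}(R)=\mathrm{rdom}(R)\circ\big((R\setminus R)\cap (R\setminus R)^{\smile}\big)$; both are pers. $R$ is a core relation iff $\mathrm{ldom}(R)=\mathrm{lper}(R)$ and $\mathrm{rdom}(R)=\mathrm{rper}(R)$. Thins on pers: for pers $P,Q$ of the same type, $P\preceq Q$ iff $P=\mathrm{dom}(P)\circ Q\circ \mathrm{dom}(P)$ and $Q=Q\circ \mathrm{dom}(P)\circ Q$. Thins on arbitrary relations $R,S$ of the same type: $R\preceq S$ iff $\mathrm{lper}(R)\preceq\mathrm{lper}(S)$ and $\mathrm{rper}(R)\preceq\mathrm{rper}(S)$ (both in the sense of thins on pers) and $R=\mathrm{ldom}(R)\circ S\circ\mathrm{rdom}(R)$. $S$ is minimal with respect to thins on arbitrary relations iff for all $R$, $R\preceq S$ implies $R=S$. *)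

theory Defs
  imports Main
begin

text \<open>
  The HOL type \<open>'t\<close> is the (non-empty) set of basic types and \<open>'r\<close> the set of all relations.
  A relation \<open>X\<close> has type \<open>src X \<sim> tgt X\<close>. The operations are total HOL functions, but the axioms
  constrain them, and the order, only on arguments of matching types.
\<close>

record ('t, 'r) relation_algebra_ops =
  src :: "'r \<Rightarrow> 't"
  tgt :: "'r \<Rightarrow> 't"
  incl :: "'r \<Rightarrow> 'r \<Rightarrow> bool" (infix "\<sqsubseteq>\<index>" 50)
  join :: "'r \<Rightarrow> 'r \<Rightarrow> 'r" (infixl "\<squnion>\<index>" 65)
  meet :: "'r \<Rightarrow> 'r \<Rightarrow> 'r" (infixl "\<sqinter>\<index>" 70)
  least_rel :: "'t \<Rightarrow> 't \<Rightarrow> 'r"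
  greatest_rel :: "'t \<Rightarrow> 't \<Rightarrow> 'r"
  ident :: "'t \<Rightarrow> 'r" ("\<one>\<index>")
  seq :: "'r \<Rightarrow> 'r \<Rightarrow> 'r" (infixl "\<odot>\<index>" 75)
  under :: "'r \<Rightarrow> 'r \<Rightarrow> 'r" (infixr "\<rightharpoonup>\<index>" 73)
  over :: "'r \<Rightarrow> 'r \<Rightarrow> 'r" (infixl "\<leftharpoondown>\<index>" 73)
  conv :: "'r \<Rightarrow> 'r" ("_\<smile>\<index>" [1000] 999)

text \<open>The factors are written \<open>X \<rightharpoonup> Z\<close> for \<open>X \<setminus> Z\<close> and \<open>Z \<leftharpoondown> Y\<close> for \<open>Z / Y\<close>.\<close>

definition rels :: "('t, 'r, 'x) relation_algebra_ops_scheme \<Rightarrow> 't \<Rightarrow> 't \<Rightarrow> 'r set" where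
  "rels \<A> A B = {X. src \<A> X = A \<and> tgt \<A> X = B}"

locale point_free_relation_algebra =
  fixes \<A> :: "('t, 'r, 'x) relation_algebra_ops_scheme" (structure)
  assumes seq_type: "\<lbrakk>X \<in> rels \<A> A B; Y \<in> rels \<A> B C\<rbrakk> \<Longrightarrow> X \<odot> Y \<in> rels \<A> A C"
    and ident_type: "\<one> A \<in> rels \<A> A A"
    and seq_assoc: "\<lbrakk>X \<in> rels \<A> A B; Y \<in> rels \<A> B C; Z \<in> rels \<A> C D\<rbrakk>
      \<Longrightarrow> (X \<odot> Y) \<odot> Z = X \<odot> (Y \<odot> Z)"
    and ident_left: "X \<in> rels \<A> A B \<Longrightarrow> \<one> A \<odot> X = X"
    and ident_right: "X \<in> rels \<A> A B \<Longrightarrow> X \<odot> \<one> B = X"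
    and incl_refl: "X \<sqsubseteq> X"
    and incl_trans: "\<lbrakk>X \<in> rels \<A> A B; Y \<in> rels \<A> A B; Z \<in> rels \<A> A B; X \<sqsubseteq> Y; Y \<sqsubseteq> Z\<rbrakk>
      \<Longrightarrow> X \<sqsubseteq> Z"
    and incl_antisym: "\<lbrakk>X \<in> rels \<A> A B; Y \<in> rels \<A> A B; X \<sqsubseteq> Y; Y \<sqsubseteq> X\<rbrakk> \<Longrightarrow> X = Y"
    and join_type: "\<lbrakk>X \<in> rels \<A> A B; Y \<in> rels \<A> A B\<rbrakk> \<Longrightarrow> X \<squnion> Y \<in> rels \<A> A B"
    and join_lub: "\<lbrakk>X \<in> rels \<A> A B; Y \<in> rels \<A> A B; Z \<in> rels \<A> A B\<rbrakk>
      \<Longrightarrow> X \<squnion> Y \<sqsubseteq> Z \<longleftrightarrow> X \<sqsubseteq> Z \<and> Y \<sqsubseteq> Z"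
    and meet_type: "\<lbrakk>X \<in> rels \<A> A B; Y \<in> rels \<A> A B\<rbrakk> \<Longrightarrow> X \<sqinter> Y \<in> rels \<A> A B"
    and meet_glb: "\<lbrakk>X \<in> rels \<A> A B; Y \<in> rels \<A> A B; Z \<in> rels \<A> A B\<rbrakk>
      \<Longrightarrow> Z \<sqsubseteq> X \<sqinter> Y \<longleftrightarrow> Z \<sqsubseteq> X \<and> Z \<sqsubseteq> Y"
    and meet_join_distrib: "\<lbrakk>X \<in> rels \<A> A B; Y \<in> rels \<A> A B; Z \<in> rels \<A> A B\<rbrakk>
      \<Longrightarrow> X \<sqinter> (Y \<squnion> Z) = (X \<sqinter> Y) \<squnion> (X \<sqinter> Z)"
    and least_type: "least_rel \<A> A B \<in> rels \<A> A B"
    and least: "X \<in> rels \<A> A B \<Longrightarrow> least_rel \<A> A B \<sqsubseteq> X"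
    and greatest_type: "greatest_rel \<A> A B \<in> rels \<A> A B"
    and greatest: "X \<in> rels \<A> A B \<Longrightarrow> X \<sqsubseteq> greatest_rel \<A> A B"
    and under_type: "\<lbrakk>X \<in> rels \<A> A B; Z \<in> rels \<A> A C\<rbrakk> \<Longrightarrow> X \<rightharpoonup> Z \<in> rels \<A> B C"
    and over_type: "\<lbrakk>Z \<in> rels \<A> A C; Y \<in> rels \<A> B C\<rbrakk> \<Longrightarrow> Z \<leftharpoondown> Y \<in> rels \<A> A B"
    and under_galois: "\<lbrakk>X \<in> rels \<A> A B; Y \<in> rels \<A> B C; Z \<in> rels \<A> A C\<rbrakk>
      \<Longrightarrow> Y \<sqsubseteq> X \<rightharpoonup> Z \<longleftrightarrow> X \<odot> Y \<sqsubseteq> Z"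
    and over_galois: "\<lbrakk>X \<in> rels \<A> A B; Y \<in> rels \<A> B C; Z \<in> rels \<A> A C\<rbrakk>
      \<Longrightarrow> X \<odot> Y \<sqsubseteq> Z \<longleftrightarrow> X \<sqsubseteq> Z \<leftharpoondown> Y"
    and conv_type: "X \<in> rels \<A> A B \<Longrightarrow> X\<smile> \<in> rels \<A> B A"
    and conv_galois: "\<lbrakk>X \<in> rels \<A> A B; Y \<in> rels \<A> B A\<rbrakk> \<Longrightarrow> X\<smile> \<sqsubseteq> Y \<longleftrightarrow> X \<sqsubseteq> Y\<smile>"
    and conv_ident: "(\<one> A)\<smile> = \<one> A"
    and conv_seq: "\<lbrakk>X \<in> rels \<A> A B; Y \<in> rels \<A> B C\<rbrakk> \<Longrightarrow> (X \<odot> Y)\<smile> = Y\<smile> \<odot> X\<smile>"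
    and modularity: "\<lbrakk>X \<in> rels \<A> A B; Y \<in> rels \<A> B C; Z \<in> rels \<A> A C\<rbrakk>
      \<Longrightarrow> (X \<odot> Y) \<sqinter> Z \<sqsubseteq> X \<odot> (Y \<sqinter> (X\<smile> \<odot> Z))"

context
  fixes \<A> :: "('t, 'r, 'x) relation_algebra_ops_scheme" (structure)
begin

definition per :: "'r \<Rightarrow> bool" where
  "per P \<longleftrightarrow> src \<A> P = tgt \<A> P \<and> P = P\<smile> \<and> P \<odot> P \<sqsubseteq> P"

definition perdom :: "'r \<Rightarrow> 'r" where
  "perdom P = \<one> (src \<A> P) \<sqinter> P"

definition is_index :: "'r \<Rightarrow> 'r \<Rightarrow> bool" where
  "is_index P J \<longleftrightarrow>
    J \<in> rels \<A> (src \<A> P) (src \<A> P) \<and> J \<sqsubseteq> perdom P \<and> J \<odot> P \<odot> J = J \<and> P \<odot> J \<odot> P = P"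

definition axiom_of_choice :: bool where
  "axiom_of_choice \<longleftrightarrow> (\<forall>P. per P \<longrightarrow> (\<exists>J. is_index P J))"

definition ldom :: "'r \<Rightarrow> 'r" where
  "ldom R = \<one> (src \<A> R) \<sqinter> (R \<odot> R\<smile>)"

definition rdom :: "'r \<Rightarrow> 'r" where
  "rdom R = \<one> (tgt \<A> R) \<sqinter> (R\<smile> \<odot> R)"

definition lper :: "'r \<Rightarrow> 'r" where
  "lper R = ldom R \<odot> ((R \<leftharpoondown> R) \<sqinter> (R \<leftharpoondown> R)\<smile>)"

definition rper :: "'r \<Rightarrow> 'r" where
  "rper R = rdom R \<odot> ((R \<rightharpoonup> R) \<sqinter> (R \<rightharpoonup> R)\<smile>)"

definition core_relation :: "'r \<Rightarrow> bool" where
  "core_relation R \<longleftrightarrow> ldom R = lper R \<and> rdom R = rper R"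

definition thins_per :: "'r \<Rightarrow> 'r \<Rightarrow> bool" where
  "thins_per P Q \<longleftrightarrow> per P \<and> per Q \<and> src \<A> P = src \<A> Q \<and>
    P = perdom P \<odot> Q \<odot> perdom P \<and> Q = Q \<odot> perdom P \<odot> Q"

definition thins :: "'r \<Rightarrow> 'r \<Rightarrow> bool" where
  "thins R S \<longleftrightarrow> src \<A> R = src \<A> S \<and> tgt \<A> R = tgt \<A> S \<and>
    thins_per (lper R) (lper S) \<and> thins_per (rper R) (rper S) \<and>
    R = ldom R \<odot> S \<odot> rdom R"

definition thins_minimal :: "'r \<Rightarrow> bool" where
  "thins_minimal S \<longleftrightarrow> (\<forall>R. thins R S \<longrightarrow> R = S)"

end

end

theory Submission
  imports Defs
begin

text \<open>
  If \<open>J\<close> and \<open>K\<close> are indexes of the left and right per-domains of \<open>S\<close>, then \<open>R = J \<odot> S \<odot> K\<close> thins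
  \<open>S\<close> and is a core relation, because \<open>ldom R = lper R = J\<close> and \<open>rdom R = rper R = K\<close>; a minimal \<open>S\<close>
  equals this \<open>R\<close>. Conversely, if \<open>S\<close> is a core relation and \<open>R\<close> thins \<open>S\<close>, then \<open>lper S\<close>
  is coreflexive, so \<open>lper S = lper S \<odot> ldom R \<odot> lper S\<close> forces \<open>ldom S \<subseteq> ldom R\<close>, dually
  \<open>rdom S \<subseteq> rdom R\<close>, and hence \<open>S \<subseteq> R \<subseteq> S\<close>.
  The right-hand facts are the left-hand ones for the converse, since \<open>rper S = lper (S\<smile>)\<close>.
\<close>

context point_free_relation_algebra
begin

section \<open>Typing rules, and the axioms restated through sources and targets\<close>

lemma rels_iff: "X \<in> rels \<A> A B \<longleftrightarrow> src \<A> X = A \<and> tgt \<A> X = B"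
  by (simp add: rels_def)

lemma src_seq [simp]: "tgt \<A> X = src \<A> Y \<Longrightarrow> src \<A> (X \<odot> Y) = src \<A> X"
  and tgt_seq [simp]: "tgt \<A> X = src \<A> Y \<Longrightarrow> tgt \<A> (X \<odot> Y) = tgt \<A> Y"
  using seq_type[unfolded rels_iff] by blast+

lemma src_ident [simp]: "src \<A> (\<one> A) = A" and tgt_ident [simp]: "tgt \<A> (\<one> A) = A"
  using ident_type[unfolded rels_iff] by blast+

lemma src_meet [simp]:
    "\<lbrakk>src \<A> X = src \<A> Y; tgt \<A> X = tgt \<A> Y\<rbrakk> \<Longrightarrow> src \<A> (X \<sqinter> Y) = src \<A> X"
  and tgt_meet [simp]:
    "\<lbrakk>src \<A> X = src \<A> Y; tgt \<A> X = tgt \<A> Y\<rbrakk> \<Longrightarrow> tgt \<A> (X \<sqinter> Y) = tgt \<A> X"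
  using meet_type[unfolded rels_iff] by metis+

lemma src_conv [simp]: "src \<A> (X\<smile>) = tgt \<A> X" and tgt_conv [simp]: "tgt \<A> (X\<smile>) = src \<A> X"
  using conv_type[unfolded rels_iff] by blast+

lemma src_under [simp]: "src \<A> X = src \<A> Z \<Longrightarrow> src \<A> (X \<rightharpoonup> Z) = tgt \<A> X"
  and tgt_under [simp]: "src \<A> X = src \<A> Z \<Longrightarrow> tgt \<A> (X \<rightharpoonup> Z) = tgt \<A> Z"
  using under_type[unfolded rels_iff] by blast+

lemma src_over [simp]: "tgt \<A> Z = tgt \<A> Y \<Longrightarrow> src \<A> (Z \<leftharpoondown> Y) = src \<A> Z"
  and tgt_over [simp]: "tgt \<A> Z = tgt \<A> Y \<Longrightarrow> tgt \<A> (Z \<leftharpoondown> Y) = src \<A> Y"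
  using over_type[unfolded rels_iff] by blast+

lemma assoc [simp]:
  "\<lbrakk>tgt \<A> X = src \<A> Y; tgt \<A> Y = src \<A> Z\<rbrakk> \<Longrightarrow> (X \<odot> Y) \<odot> Z = X \<odot> (Y \<odot> Z)"
  using seq_assoc[unfolded rels_iff] by blast

lemma ident_seq [simp]: "src \<A> X = A \<Longrightarrow> \<one> A \<odot> X = X"
  and seq_ident [simp]: "tgt \<A> X = A \<Longrightarrow> X \<odot> \<one> A = X"
  using ident_left[unfolded rels_iff] ident_right[unfolded rels_iff] by blast+

lemma conv_seq_typed [simp]: "tgt \<A> X = src \<A> Y \<Longrightarrow> (X \<odot> Y)\<smile> = Y\<smile> \<odot> X\<smile>"
  using conv_seq[unfolded rels_iff] by blast

declare conv_ident [simp]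

text \<open>Inclusion between relations of the same type; unlike \<open>\<sqsubseteq>\<close> it is unconditionally a partial order.\<close>

definition subrel :: "'r \<Rightarrow> 'r \<Rightarrow> bool" (infix "\<preceq>" 50) where
  "X \<preceq> Y \<longleftrightarrow> src \<A> X = src \<A> Y \<and> tgt \<A> X = tgt \<A> Y \<and> X \<sqsubseteq> Y"

lemma subrel_src: "X \<preceq> Y \<Longrightarrow> src \<A> X = src \<A> Y"
  and subrel_tgt: "X \<preceq> Y \<Longrightarrow> tgt \<A> X = tgt \<A> Y"
  by (simp_all add: subrel_def)

lemma subrel_refl [simp]: "X \<preceq> X"
  by (simp add: subrel_def incl_refl)

lemma subrel_trans [trans]: "\<lbrakk>X \<preceq> Y; Y \<preceq> Z\<rbrakk> \<Longrightarrow> X \<preceq> Z"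
  using incl_trans[unfolded rels_iff] unfolding subrel_def by metis

lemma subrel_antisym: "\<lbrakk>X \<preceq> Y; Y \<preceq> X\<rbrakk> \<Longrightarrow> X = Y"
  using incl_antisym[unfolded rels_iff] unfolding subrel_def by metis

lemma subrel_meet_iff:
  "\<lbrakk>src \<A> X = src \<A> Y; tgt \<A> X = tgt \<A> Y\<rbrakk> \<Longrightarrow> Z \<preceq> X \<sqinter> Y \<longleftrightarrow> Z \<preceq> X \<and> Z \<preceq> Y"
  using meet_glb[unfolded rels_iff] unfolding subrel_def by auto

lemma meet_subrel1: "\<lbrakk>src \<A> X = src \<A> Y; tgt \<A> X = tgt \<A> Y\<rbrakk> \<Longrightarrow> X \<sqinter> Y \<preceq> X"
  and meet_subrel2: "\<lbrakk>src \<A> X = src \<A> Y; tgt \<A> X = tgt \<A> Y\<rbrakk> \<Longrightarrow> X \<sqinter> Y \<preceq> Y"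
  using subrel_meet_iff[of X Y "X \<sqinter> Y"] by simp_all

lemma meet_commute:
  "\<lbrakk>src \<A> X = src \<A> Y; tgt \<A> X = tgt \<A> Y\<rbrakk> \<Longrightarrow> X \<sqinter> Y = Y \<sqinter> X"
  by (rule subrel_antisym) (simp_all add: subrel_meet_iff meet_subrel1 meet_subrel2)

lemma subrel_under_iff:
  "\<lbrakk>tgt \<A> X = src \<A> Y; src \<A> X = src \<A> Z; tgt \<A> Y = tgt \<A> Z\<rbrakk>
    \<Longrightarrow> Y \<preceq> X \<rightharpoonup> Z \<longleftrightarrow> X \<odot> Y \<preceq> Z"
  using under_galois[unfolded rels_iff] unfolding subrel_def by auto

lemma subrel_over_iff:
  "\<lbrakk>tgt \<A> X = src \<A> Y; src \<A> X = src \<A> Z; tgt \<A> Y = tgt \<A> Z\<rbrakk>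
    \<Longrightarrow> X \<preceq> Z \<leftharpoondown> Y \<longleftrightarrow> X \<odot> Y \<preceq> Z"
  using over_galois[unfolded rels_iff] unfolding subrel_def by auto

text \<open>Composition with one argument fixed is the lower adjoint of a factor, so each of the two
  inclusions is obtained by transposing along the unit of its Galois connection.\<close>

lemma seq_mono:
  assumes "X \<preceq> X'" and "Y \<preceq> Y'" and "tgt \<A> X = src \<A> Y"
  shows "X \<odot> Y \<preceq> X' \<odot> Y'"
proof -
  note ty = subrel_src[OF assms(1)] subrel_tgt[OF assms(1)] subrel_src[OF assms(2)]
    subrel_tgt[OF assms(2)] assms(3)
  have "Y' \<preceq> X \<rightharpoonup> (X \<odot> Y')"
    by (subst subrel_under_iff) (use ty in auto)
  with assms(2) have "Y \<preceq> X \<rightharpoonup> (X \<odot> Y')"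
    by (rule subrel_trans)
  then have "X \<odot> Y \<preceq> X \<odot> Y'"
    by (subst (asm) subrel_under_iff) (use ty in auto)
  also have "X' \<preceq> (X' \<odot> Y') \<leftharpoondown> Y'"
    by (subst subrel_over_iff) (use ty in auto)
  with assms(1) have "X \<preceq> (X' \<odot> Y') \<leftharpoondown> Y'"
    by (rule subrel_trans)
  then have "X \<odot> Y' \<preceq> X' \<odot> Y'"
    by (subst (asm) subrel_over_iff) (use ty in auto)
  finally show ?thesis .
qed

lemma conv_subrel_iff: "X\<smile> \<preceq> Y \<longleftrightarrow> X \<preceq> Y\<smile>"
  using conv_galois[unfolded rels_iff] unfolding subrel_def by auto

text \<open>Converse is Galois adjoint to itself, so both inclusions transpose to
  \<open>X\<smile> \<preceq> X\<smile>\<close>.\<close>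

lemma conv_conv [simp]: "(X\<smile>)\<smile> = X"
  by (rule subrel_antisym) (simp_all add: conv_subrel_iff flip: conv_subrel_iff[of X])

lemma conv_mono: "X \<preceq> Y \<Longrightarrow> X\<smile> \<preceq> Y\<smile>"
  by (simp add: conv_subrel_iff)

lemma conv_meet [simp]:
  assumes "src \<A> X = src \<A> Y" and "tgt \<A> X = tgt \<A> Y"
  shows "(X \<sqinter> Y)\<smile> = X\<smile> \<sqinter> Y\<smile>"
proof (rule subrel_antisym)
  show "(X \<sqinter> Y)\<smile> \<preceq> X\<smile> \<sqinter> Y\<smile>"
    using assms by (simp add: subrel_meet_iff conv_mono meet_subrel1 meet_subrel2)
  have "(X\<smile> \<sqinter> Y\<smile>)\<smile> \<preceq> (X\<smile>)\<smile>" and "(X\<smile> \<sqinter> Y\<smile>)\<smile> \<preceq> (Y\<smile>)\<smile>"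
    using assms by (simp_all only: conv_mono meet_subrel1 meet_subrel2 src_conv tgt_conv)
  then have "(X\<smile> \<sqinter> Y\<smile>)\<smile> \<preceq> X \<sqinter> Y"
    using assms by (simp add: subrel_meet_iff)
  then show "X\<smile> \<sqinter> Y\<smile> \<preceq> (X \<sqinter> Y)\<smile>"
    by (simp add: conv_subrel_iff)
qed

lemma modular:
  "\<lbrakk>tgt \<A> X = src \<A> Y; src \<A> X = src \<A> Z; tgt \<A> Y = tgt \<A> Z\<rbrakk>
    \<Longrightarrow> (X \<odot> Y) \<sqinter> Z \<preceq> X \<odot> (Y \<sqinter> (X\<smile> \<odot> Z))"
  using modularity[unfolded rels_iff] unfolding subrel_def by auto

section \<open>Domains and coreflexive relations\<close>

lemma src_ldom [simp]: "src \<A> (ldom \<A> R) = src \<A> R"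
  and tgt_ldom [simp]: "tgt \<A> (ldom \<A> R) = src \<A> R"
  by (simp_all add: ldom_def)

lemma ldom_conv: "ldom \<A> (R\<smile>) = rdom \<A> R"
  by (simp add: ldom_def rdom_def)

text \<open>This is the modularity law with the identity as middle factor; the term it produces is
  exactly \<open>rdom\<close>.\<close>

lemma subrel_seq_rdom: "X \<preceq> X \<odot> rdom \<A> X"
proof -
  have "X \<preceq> (X \<odot> \<one> (tgt \<A> X)) \<sqinter> X"
    by (simp add: subrel_meet_iff)
  also have "\<dots> \<preceq> X \<odot> rdom \<A> X"
    unfolding rdom_def by (rule modular) simp_all
  finally show ?thesis .
qed

text \<open>A coreflexive \<open>q\<close> lies below \<open>q \<odot> q\<smile> \<odot> q\<close>,
  and bounding both outer factors by the identity leaves \<open>q\<smile>\<close>. The reverse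
  inclusion is the transpose of this one.\<close>

lemma coreflexive_conv:
  assumes p: "p \<preceq> \<one> A"
  shows "p\<smile> = p"
proof -
  have ty: "src \<A> p = A" "tgt \<A> p = A"
    using subrel_src[OF p] subrel_tgt[OF p] by simp_all
  have p': "q \<preceq> q\<smile>" if q: "q \<preceq> \<one> A" "src \<A> q = A" "tgt \<A> q = A" for q
  proof -
    have "q \<preceq> q \<odot> rdom \<A> q"
      by (rule subrel_seq_rdom)
    also have "\<dots> \<preceq> q \<odot> (q\<smile> \<odot> q)"
      unfolding rdom_def using q by (intro seq_mono meet_subrel2) simp_all
    also have "\<dots> \<preceq> \<one> A \<odot> (q\<smile> \<odot> \<one> A)"
      using q by (intro seq_mono) simp_all
    also have "\<dots> = q\<smile>"
      using q by simp
    finally show ?thesis .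
  qed
  have "p \<preceq> p\<smile>"
    using p' p ty by blast
  then show ?thesis
    by (intro subrel_antisym) (simp_all add: conv_subrel_iff)
qed

lemma coreflexive_idem:
  assumes p: "p \<preceq> \<one> A"
  shows "p \<odot> p = p"
proof (rule subrel_antisym)
  have ty: "src \<A> p = A" "tgt \<A> p = A"
    using subrel_src[OF p] subrel_tgt[OF p] by simp_all
  show "p \<odot> p \<preceq> p"
    using seq_mono[OF p subrel_refl[of p]] ty by simp
  have "p \<preceq> p \<odot> rdom \<A> p"
    by (rule subrel_seq_rdom)
  also have "\<dots> \<preceq> p \<odot> (p \<odot> p)"
    unfolding rdom_def coreflexive_conv[OF p] using ty
    by (intro seq_mono meet_subrel2) simp_all
  also have "\<dots> \<preceq> p \<odot> (\<one> A \<odot> p)"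
    using p ty by (intro seq_mono) simp_all
  finally show "p \<preceq> p \<odot> p"
    using ty by simp
qed

lemma coreflexive_seq_subrel:
  assumes "p \<preceq> \<one> A" and "src \<A> X = A"
  shows "p \<odot> X \<preceq> X"
  using seq_mono[OF assms(1) subrel_refl[of X]] assms by (simp add: subrel_tgt)

lemma seq_coreflexive_subrel:
  assumes "p \<preceq> \<one> A" and "tgt \<A> X = A"
  shows "X \<odot> p \<preceq> X"
  using seq_mono[OF subrel_refl[of X] assms(1)] assms by (simp add: subrel_src)

lemma ident_meet_coreflexive_seq:
  assumes p: "p \<preceq> \<one> A" and X: "src \<A> X = A" "tgt \<A> X = A"
  shows "\<one> A \<sqinter> (p \<odot> X) \<preceq> p"
proof -
  have ty: "src \<A> p = A" "tgt \<A> p = A"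
    using subrel_src[OF p] subrel_tgt[OF p] by simp_all
  have "\<one> A \<sqinter> (p \<odot> X) = (p \<odot> X) \<sqinter> \<one> A"
    using ty X by (intro meet_commute) simp_all
  also have "\<dots> \<preceq> p \<odot> (X \<sqinter> (p\<smile> \<odot> \<one> A))"
    using ty X by (intro modular) simp_all
  also have "\<dots> \<preceq> p \<odot> (p\<smile> \<odot> \<one> A)"
    using ty X by (intro seq_mono meet_subrel2) simp_all
  also have "\<dots> = p"
    using ty by (simp add: coreflexive_conv[OF p] coreflexive_idem[OF p])
  finally show ?thesis .
qed

lemma ldom_subrel_ident: "ldom \<A> R \<preceq> \<one> (src \<A> R)"
  and ldom_subrel_seq_conv: "ldom \<A> R \<preceq> R \<odot> R\<smile>"
  by (simp_all add: ldom_def meet_subrel1 meet_subrel2)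

lemma ldom_seq: "ldom \<A> R \<odot> R = R"
proof (rule subrel_antisym)
  show "ldom \<A> R \<odot> R \<preceq> R"
    by (rule coreflexive_seq_subrel[OF ldom_subrel_ident]) simp
  have "R\<smile> \<preceq> R\<smile> \<odot> rdom \<A> (R\<smile>)"
    by (rule subrel_seq_rdom)
  also have "rdom \<A> (R\<smile>) = ldom \<A> R"
    by (simp flip: ldom_conv)
  finally show "R \<preceq> ldom \<A> R \<odot> R"
    by (simp add: conv_subrel_iff coreflexive_conv[OF ldom_subrel_ident])
qed

section \<open>The left per-domain\<close>

text \<open>For concrete binary relations this is the equivalence on the source that identifies
  points with the same image under \<open>R\<close>; \<open>lper\<close> is its restriction to the
  left domain.\<close>

definition lequiv :: "'r \<Rightarrow> 'r" where
  "lequiv R = (R \<leftharpoondown> R) \<sqinter> (R \<leftharpoondown> R)\<smile>"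

lemma src_lequiv [simp]: "src \<A> (lequiv R) = src \<A> R"
  and tgt_lequiv [simp]: "tgt \<A> (lequiv R) = src \<A> R"
  by (simp_all add: lequiv_def)

lemma lper_eq: "lper \<A> R = ldom \<A> R \<odot> lequiv R"
  by (simp add: lper_def lequiv_def)

lemma src_lper [simp]: "src \<A> (lper \<A> R) = src \<A> R"
  and tgt_lper [simp]: "tgt \<A> (lper \<A> R) = src \<A> R"
  by (simp_all add: lper_eq)

lemma subrel_lequiv_iff:
  assumes "src \<A> X = src \<A> R" and "tgt \<A> X = src \<A> R"
  shows "X \<preceq> lequiv R \<longleftrightarrow> X \<odot> R \<preceq> R \<and> X\<smile> \<odot> R \<preceq> R"
  using assms by (simp add: lequiv_def subrel_meet_iff subrel_over_iff flip: conv_subrel_iff)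

lemma lequiv_conv [simp]: "(lequiv R)\<smile> = lequiv R"
  unfolding lequiv_def by (simp add: meet_commute)

lemma lequiv_seq_subrel: "lequiv R \<odot> R \<preceq> R"
  using subrel_lequiv_iff[of "lequiv R" R] by simp

lemma ident_subrel_lequiv: "\<one> (src \<A> R) \<preceq> lequiv R"
  by (simp add: subrel_lequiv_iff)

lemma conv_seq_lequiv_subrel: "R\<smile> \<odot> lequiv R \<preceq> R\<smile>"
  using conv_mono[OF lequiv_seq_subrel[of R]] by simp

lemma lequiv_idem_subrel: "lequiv R \<odot> lequiv R \<preceq> lequiv R"
proof -
  have "lequiv R \<odot> (lequiv R \<odot> R) \<preceq> lequiv R \<odot> R"
    by (intro seq_mono lequiv_seq_subrel) simp_all
  also note lequiv_seq_subrel
  finally show ?thesis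
    by (simp add: subrel_lequiv_iff)
qed

text \<open>A point equivalent to one in the left domain is itself in the left domain, so
  restricting \<open>lequiv\<close> on one side already restricts it on the other. The symmetry of
  \<open>lper\<close> rests on this.\<close>

lemma lper_seq_ldom: "lper \<A> R \<odot> ldom \<A> R = lper \<A> R"
proof (rule subrel_antisym)
  let ?a = "ldom \<A> R" and ?E = "lequiv R"
  show "lper \<A> R \<odot> ?a \<preceq> lper \<A> R"
    by (rule seq_coreflexive_subrel[OF ldom_subrel_ident]) simp
  \<comment> \<open>The aim is to bound the right domain of \<open>lper \<A> R\<close> by
    \<open>?a\<close>; once \<open>?a\<close> is replaced by \<open>R \<odot> R\<smile>\<close>,
    both copies of \<open>?E\<close> are absorbed by \<open>R\<close>.\<close>
  have "(lper \<A> R)\<smile> \<odot> lper \<A> R = ?E \<odot> (?a \<odot> ?a) \<odot> ?E"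
    by (simp add: lper_eq coreflexive_conv[OF ldom_subrel_ident])
  also have "\<dots> = ?E \<odot> ?a \<odot> ?E"
    by (simp only: coreflexive_idem[OF ldom_subrel_ident])
  also have "\<dots> \<preceq> ?E \<odot> (R \<odot> R\<smile>) \<odot> ?E"
    by (intro seq_mono ldom_subrel_seq_conv) simp_all
  also have "\<dots> = (?E \<odot> R) \<odot> (R\<smile> \<odot> ?E)"
    by simp
  also have "\<dots> \<preceq> R \<odot> R\<smile>"
    by (intro seq_mono lequiv_seq_subrel conv_seq_lequiv_subrel) simp_all
  finally have "(lper \<A> R)\<smile> \<odot> lper \<A> R \<preceq> R \<odot> R\<smile>" .
  moreover have "rdom \<A> (lper \<A> R) \<preceq> (lper \<A> R)\<smile> \<odot> lper \<A> R"
    by (simp add: rdom_def meet_subrel2)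
  moreover have "rdom \<A> (lper \<A> R) \<preceq> \<one> (src \<A> R)"
    by (simp add: rdom_def meet_subrel1)
  ultimately have "rdom \<A> (lper \<A> R) \<preceq> ?a"
    by (auto simp: ldom_def subrel_meet_iff intro: subrel_trans)
  moreover have "src \<A> (rdom \<A> (lper \<A> R)) = src \<A> R"
    by (simp add: rdom_def)
  ultimately have "lper \<A> R \<odot> rdom \<A> (lper \<A> R) \<preceq> lper \<A> R \<odot> ?a"
    by (intro seq_mono) simp_all
  then show "lper \<A> R \<preceq> lper \<A> R \<odot> ?a"
    by (rule subrel_trans[OF subrel_seq_rdom])
qed

lemma lper_eq_sandwich: "lper \<A> R = ldom \<A> R \<odot> lequiv R \<odot> ldom \<A> R"
  using lper_seq_ldom[of R] by (simp add: lper_eq)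

lemma lper_conv [simp]: "(lper \<A> R)\<smile> = lper \<A> R"
  by (simp add: lper_eq_sandwich coreflexive_conv[OF ldom_subrel_ident])

lemma lper_subrel_lequiv: "lper \<A> R \<preceq> lequiv R"
  unfolding lper_eq by (rule coreflexive_seq_subrel[OF ldom_subrel_ident]) simp

lemma per_lper: "per \<A> (lper \<A> R)"
proof -
  have "lper \<A> R \<odot> lper \<A> R = ldom \<A> R \<odot> (lequiv R \<odot> lper \<A> R)"
    by (subst (1) lper_eq) simp
  also have "\<dots> \<preceq> ldom \<A> R \<odot> (lequiv R \<odot> lequiv R)"
    by (intro seq_mono lper_subrel_lequiv) simp_all
  also have "\<dots> \<preceq> ldom \<A> R \<odot> lequiv R"
    by (intro seq_mono lequiv_idem_subrel) simp_all
  finally show ?thesis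
    by (simp add: per_def subrel_def flip: lper_eq)
qed

lemma ldom_subrel_lper: "ldom \<A> R \<preceq> lper \<A> R"
  using seq_mono[OF subrel_refl[of "ldom \<A> R"] ident_subrel_lequiv[of R]]
  by (simp add: lper_eq)

lemma lper_seq: "lper \<A> R \<odot> R = R"
proof (rule subrel_antisym)
  have "lper \<A> R \<odot> R \<preceq> lequiv R \<odot> R"
    by (intro seq_mono lper_subrel_lequiv) simp_all
  also note lequiv_seq_subrel
  finally show "lper \<A> R \<odot> R \<preceq> R" .
  have "ldom \<A> R \<odot> R \<preceq> lper \<A> R \<odot> R"
    by (intro seq_mono ldom_subrel_lper) simp_all
  then show "R \<preceq> lper \<A> R \<odot> R"
    by (simp add: ldom_seq)
qed

text \<open>Indexes and thins on pers are phrased with \<open>perdom\<close>; this turns them into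
  statements about \<open>ldom\<close>.\<close>

lemma perdom_lper: "perdom \<A> (lper \<A> R) = ldom \<A> R"
proof (rule subrel_antisym)
  show "perdom \<A> (lper \<A> R) \<preceq> ldom \<A> R"
    unfolding perdom_def lper_eq
    by (simp add: ident_meet_coreflexive_seq[OF ldom_subrel_ident])
  show "ldom \<A> R \<preceq> perdom \<A> (lper \<A> R)"
    by (simp add: perdom_def subrel_meet_iff ldom_subrel_ident ldom_subrel_lper)
qed

text \<open>Converse exchanges the two factors, which reduces every fact about \<open>rper\<close>
  to one about \<open>lper\<close>.\<close>

lemma lper_conv_eq_rper: "lper \<A> (R\<smile>) = rper \<A> R"
proof -
  have *: "R\<smile> \<leftharpoondown> R\<smile> = (R \<rightharpoonup> R)\<smile>"
  proof (rule subrel_antisym)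
    have "(R\<smile> \<leftharpoondown> R\<smile>) \<odot> R\<smile> \<preceq> R\<smile>"
      using subrel_over_iff[of "R\<smile> \<leftharpoondown> R\<smile>" "R\<smile>" "R\<smile>"] by simp
    then have "R \<odot> (R\<smile> \<leftharpoondown> R\<smile>)\<smile> \<preceq> R"
      using conv_mono by fastforce
    then show "R\<smile> \<leftharpoondown> R\<smile> \<preceq> (R \<rightharpoonup> R)\<smile>"
      by (simp add: subrel_under_iff flip: conv_subrel_iff)
    have "R \<odot> (R \<rightharpoonup> R) \<preceq> R"
      using subrel_under_iff[of R "R \<rightharpoonup> R" R] by simp
    then have "(R \<rightharpoonup> R)\<smile> \<odot> R\<smile> \<preceq> R\<smile>"
      using conv_mono by fastforce
    then show "(R \<rightharpoonup> R)\<smile> \<preceq> R\<smile> \<leftharpoondown> R\<smile>"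
      by (simp add: subrel_over_iff)
  qed
  show ?thesis
    unfolding lper_def rper_def ldom_conv * by (simp add: meet_commute)
qed

lemma src_rper [simp]: "src \<A> (rper \<A> R) = tgt \<A> R"
  and tgt_rper [simp]: "tgt \<A> (rper \<A> R) = tgt \<A> R"
  by (simp_all flip: lper_conv_eq_rper)

lemma seq_rper: "R \<odot> rper \<A> R = R"
proof -
  have "(rper \<A> R \<odot> R\<smile>)\<smile> = (R\<smile>)\<smile>"
    using lper_seq[of "R\<smile>"] by (simp add: lper_conv_eq_rper)
  then show ?thesis
    by (simp flip: lper_conv_eq_rper)
qed

section \<open>Cutting a relation down to indexes of its per-domains\<close>

lemma index_lperD:
  assumes "is_index \<A> (lper \<A> S) J"
  shows "J \<preceq> \<one> (src \<A> S)" and "J \<preceq> ldom \<A> S"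
    and "src \<A> J = src \<A> S" and "tgt \<A> J = src \<A> S"
    and "J \<odot> lper \<A> S \<odot> J = J" and "lper \<A> S \<odot> J \<odot> lper \<A> S = lper \<A> S"
proof -
  show ty: "src \<A> J = src \<A> S" "tgt \<A> J = src \<A> S"
    and "J \<odot> lper \<A> S \<odot> J = J" "lper \<A> S \<odot> J \<odot> lper \<A> S = lper \<A> S"
    using assms by (simp_all add: is_index_def rels_iff)
  show J: "J \<preceq> ldom \<A> S"
    using assms ty by (simp add: is_index_def perdom_lper subrel_def)
  show "J \<preceq> \<one> (src \<A> S)"
    using J ldom_subrel_ident by (rule subrel_trans)
qed

context
  fixes S J K
  assumes J: "is_index \<A> (lper \<A> S) J" and K: "is_index \<A> (rper \<A> S) K"
begin

lemma index_rper_types [simp]: "src \<A> K = tgt \<A> S" "tgt \<A> K = tgt \<A> S"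
  and index_rper_coreflexive: "K \<preceq> \<one> (tgt \<A> S)"
  and rper_index: "rper \<A> S \<odot> K \<odot> rper \<A> S = rper \<A> S"
  using index_lperD[of "S\<smile>" K] K by (simp_all add: lper_conv_eq_rper)

lemmas [simp] = index_lperD(3,4)[OF J]

text \<open>\<open>S\<close> absorbs \<open>rper \<A> S\<close> on the right, and the index law lets
  \<open>K\<close> be inserted between two copies of it. So \<open>S\<close> can be recovered from
  \<open>S \<odot> K\<close>.\<close>

lemma seq_index_rper: "S \<odot> K \<odot> rper \<A> S = S"
proof -
  have "S \<odot> K \<odot> rper \<A> S = (S \<odot> rper \<A> S) \<odot> K \<odot> rper \<A> S"
    by (simp only: seq_rper)
  also have "\<dots> = S \<odot> (rper \<A> S \<odot> K \<odot> rper \<A> S)"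
    by simp
  also have "\<dots> = S"
    by (simp only: rper_index seq_rper)
  finally show ?thesis .
qed

text \<open>Restricting the intermediate points to \<open>K\<close> loses nothing, since
  \<open>K\<close> represents every class of \<open>rper \<A> S\<close>.\<close>

lemma seq_index_conv: "S \<odot> K \<odot> S\<smile> = S \<odot> S\<smile>"
proof -
  have "rper \<A> S \<odot> S\<smile> = S\<smile>"
    using lper_seq[of "S\<smile>"] by (simp add: lper_conv_eq_rper)
  then have "S \<odot> K \<odot> S\<smile> = S \<odot> K \<odot> (rper \<A> S \<odot> S\<smile>)"
    by simp
  also have "\<dots> = (S \<odot> K \<odot> rper \<A> S) \<odot> S\<smile>"
    by simp
  finally show ?thesis
    by (simp only: seq_index_rper)
qed

text \<open>By \<open>seq_index_conv\<close> the factor \<open>K\<close> disappears from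
  \<open>?R \<odot> ?R\<smile>\<close>. The upper bound then comes from the leading coreflexive
  \<open>J\<close>, and the lower bound from
  \<open>J \<preceq> ldom \<A> S \<preceq> S \<odot> S\<smile>\<close>.\<close>

lemma ldom_index_seq: "ldom \<A> (J \<odot> S \<odot> K) = J"
proof (rule subrel_antisym)
  note Jc = index_lperD(1)[OF J]
  let ?R = "J \<odot> S \<odot> K"
  have "?R \<odot> ?R\<smile> = J \<odot> S \<odot> (K \<odot> K) \<odot> S\<smile> \<odot> J"
    by (simp add: coreflexive_conv[OF Jc] coreflexive_conv[OF index_rper_coreflexive])
  also have "\<dots> = J \<odot> (S \<odot> K \<odot> S\<smile>) \<odot> J"
    by (simp add: coreflexive_idem[OF index_rper_coreflexive])
  finally have RR: "?R \<odot> ?R\<smile> = J \<odot> ((S \<odot> S\<smile>) \<odot> J)"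
    unfolding seq_index_conv by simp
  have "ldom \<A> ?R = \<one> (src \<A> S) \<sqinter> (J \<odot> ((S \<odot> S\<smile>) \<odot> J))"
    unfolding ldom_def RR by simp
  also have "\<dots> \<preceq> J"
    by (rule ident_meet_coreflexive_seq[OF Jc]) simp_all
  finally show "ldom \<A> ?R \<preceq> J" .
  have "J = J \<odot> (J \<odot> J)"
    by (simp add: coreflexive_idem[OF Jc])
  also have "\<dots> \<preceq> J \<odot> ((S \<odot> S\<smile>) \<odot> J)"
    by (intro seq_mono subrel_trans[OF index_lperD(2)[OF J] ldom_subrel_seq_conv]) simp_all
  finally show "J \<preceq> ldom \<A> ?R"
    unfolding ldom_def RR using Jc by (simp add: subrel_meet_iff)
qed

text \<open>Points of \<open>J\<close> that \<open>?R\<close> cannot distinguish are not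
  distinguished by \<open>S\<close> either, because \<open>?R\<close> determines
  \<open>J \<odot> S\<close>. Hence \<open>lper \<A> ?R\<close> lies below
  \<open>lper \<A> S\<close>, whose restriction to \<open>J\<close> on both sides is just
  \<open>J\<close>.\<close>

lemma lper_index_seq: "lper \<A> (J \<odot> S \<odot> K) = J"
proof (rule subrel_antisym)
  note Jc = index_lperD(1)[OF J]
  let ?R = "J \<odot> S \<odot> K" and ?Q = "rper \<A> S"
  define F where "F = lequiv ?R"
  define X where "X = J \<odot> F \<odot> J"
  have [simp]: "src \<A> F = src \<A> S" "tgt \<A> F = src \<A> S" "F\<smile> = F"
    by (simp_all add: F_def)
  have [simp]: "src \<A> X = src \<A> S" "tgt \<A> X = src \<A> S" "X\<smile> = X"
    by (simp_all add: X_def coreflexive_conv[OF Jc])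
  have X: "lper \<A> ?R = X"
    by (simp only: lper_eq_sandwich ldom_index_seq X_def F_def)
  show "J \<preceq> lper \<A> ?R"
    using ldom_subrel_lper[of ?R] by (simp only: ldom_index_seq)
  \<comment> \<open>Expanding \<open>S\<close> makes the factor \<open>?R\<close> appear behind
    \<open>F\<close>, which it absorbs; collapsing the expansion afterwards leaves
    \<open>J \<odot> S\<close>.\<close>
  have "X \<odot> S = X \<odot> (S \<odot> K \<odot> ?Q)"
    by (simp only: seq_index_rper)
  also have "\<dots> = J \<odot> ((F \<odot> ?R) \<odot> ?Q)"
    by (simp add: X_def)
  also have "\<dots> \<preceq> J \<odot> (?R \<odot> ?Q)"
    unfolding F_def by (intro seq_mono lequiv_seq_subrel) simp_all
  also have "\<dots> = (J \<odot> J) \<odot> (S \<odot> K \<odot> ?Q)"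
    by simp
  also have "\<dots> = J \<odot> S"
    by (simp only: seq_index_rper coreflexive_idem[OF Jc])
  also have "\<dots> \<preceq> S"
    by (rule coreflexive_seq_subrel[OF Jc]) simp
  \<comment> \<open>Since \<open>X\<close> is its own converse, the single inclusion
    \<open>X \<odot> S \<preceq> S\<close> covers both conditions.\<close>
  finally have XE: "X \<preceq> lequiv S"
    by (simp add: subrel_lequiv_iff)
  have JX: "J \<odot> X = X" and XJ: "X \<odot> J = X"
  proof -
    have "J \<odot> X = (J \<odot> J) \<odot> F \<odot> J" "X \<odot> J = J \<odot> F \<odot> (J \<odot> J)"
      by (simp_all add: X_def)
    then show "J \<odot> X = X" "X \<odot> J = X"
      by (simp_all only: coreflexive_idem[OF Jc] X_def)
  qed
  have "J \<odot> X \<preceq> ldom \<A> S \<odot> lequiv S"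
    by (intro seq_mono XE index_lperD(2)[OF J]) simp_all
  then have XP: "X \<preceq> lper \<A> S"
    by (simp only: JX lper_eq)
  have "J \<odot> X \<odot> J \<preceq> J \<odot> lper \<A> S \<odot> J"
    by (intro seq_mono XP) simp_all
  then show "lper \<A> ?R \<preceq> J"
    by (simp only: JX XJ X index_lperD(5)[OF J])
qed

text \<open>With \<open>perdom\<close> and \<open>lper\<close> of the cut-down relation both equal
  to \<open>J\<close>, the two thins conditions are the two index laws.\<close>

lemma thins_per_index: "thins_per \<A> (lper \<A> (J \<odot> S \<odot> K)) (lper \<A> S)"
  using per_lper[of "J \<odot> S \<odot> K"] per_lper[of S] index_lperD(5,6)[OF J]
  unfolding thins_per_def perdom_lper ldom_index_seq unfolding lper_index_seq by simp

end

section \<open>Minimality and core relations\<close>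

text \<open>For a core \<open>S\<close>, the second thins condition reads
  \<open>?s = ?s \<odot> ?p \<odot> ?s\<close>, and dropping the coreflexive \<open>?s\<close> on
  both sides gives the bound.\<close>

lemma ldom_subrel_of_thins_per:
  assumes "thins_per \<A> (lper \<A> R) (lper \<A> S)" and core: "ldom \<A> S = lper \<A> S"
    and ty: "src \<A> R = src \<A> S"
  shows "ldom \<A> S \<preceq> ldom \<A> R"
proof -
  let ?s = "ldom \<A> S" and ?p = "ldom \<A> R"
  have s: "?s \<preceq> \<one> (src \<A> S)"
    by (rule ldom_subrel_ident)
  have "?s = ?s \<odot> ?p \<odot> ?s"
    using assms by (simp add: thins_per_def perdom_lper)
  also have "\<dots> \<preceq> ?s \<odot> ?p"
    using ty by (intro seq_coreflexive_subrel[OF s]) simp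
  also have "\<dots> \<preceq> ?p"
    using ty by (intro coreflexive_seq_subrel[OF s]) simp
  finally show ?thesis .
qed

lemma thins_minimal_if_core:
  assumes core: "core_relation \<A> S"
  shows "thins_minimal \<A> S"
  unfolding thins_minimal_def
proof (intro allI impI)
  fix R
  assume R: "thins \<A> R S"
  let ?a = "ldom \<A> R" and ?b = "rdom \<A> R"
  have ty: "src \<A> R = src \<A> S" "tgt \<A> R = tgt \<A> S" and eq: "R = ?a \<odot> S \<odot> ?b"
    using R unfolding thins_def by blast+
  have a: "ldom \<A> S \<preceq> ?a"
    using R core ty by (intro ldom_subrel_of_thins_per) (simp_all add: thins_def core_relation_def)
  \<comment> \<open>The same bound applied to the converses of \<open>R\<close> and
    \<open>S\<close>.\<close>
  have b: "rdom \<A> S \<preceq> ?b"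
    using R core ty ldom_subrel_of_thins_per[of "R\<smile>" "S\<smile>"]
    by (simp add: thins_def core_relation_def ldom_conv lper_conv_eq_rper)
  have rty: "src \<A> (rdom \<A> X) = tgt \<A> X" "tgt \<A> (rdom \<A> X) = tgt \<A> X" for X
    by (simp_all flip: ldom_conv)
  show "R = S"
  proof (rule subrel_antisym)
    have "?b \<preceq> \<one> (tgt \<A> S)"
      using ldom_subrel_ident[of "R\<smile>"] ty by (simp add: ldom_conv)
    then have "?a \<odot> S \<odot> ?b \<preceq> ?a \<odot> S"
      using ty by (intro seq_coreflexive_subrel) simp_all
    also have "\<dots> \<preceq> S"
      using ldom_subrel_ident[of R] ty by (intro coreflexive_seq_subrel) simp_all
    finally show "R \<preceq> S"
      using eq by simp
    have "S \<preceq> S \<odot> rdom \<A> S"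
      by (rule subrel_seq_rdom)
    also have "\<dots> = ldom \<A> S \<odot> S \<odot> rdom \<A> S"
      by (simp only: ldom_seq)
    also have "\<dots> \<preceq> ?a \<odot> S \<odot> ?b"
      using a b ty rty by (intro seq_mono) simp_all
    finally show "S \<preceq> R"
      using eq by simp
  qed
qed

lemma core_if_thins_minimal:
  assumes ac: "axiom_of_choice \<A>" and min: "thins_minimal \<A> S"
  shows "core_relation \<A> S"
proof -
  have "per \<A> (rper \<A> S)"
    using per_lper[of "S\<smile>"] by (simp only: lper_conv_eq_rper)
  then obtain J K where J: "is_index \<A> (lper \<A> S) J" and K: "is_index \<A> (rper \<A> S) K"
    using ac per_lper[of S] unfolding axiom_of_choice_def by blast
  \<comment> \<open>Passing to \<open>S\<smile>\<close> swaps the roles of the indexes, so the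
    left-hand results apply with \<open>K\<close> first and \<open>J\<close> second.\<close>
  have J': "is_index \<A> (rper \<A> (S\<smile>)) J" and K': "is_index \<A> (lper \<A> (S\<smile>)) K"
    using J K by (simp_all flip: lper_conv_eq_rper)
  let ?R = "J \<odot> S \<odot> K"
  note Jd = index_lperD[OF J] and Kd = index_lperD[OF K']
  \<comment> \<open>The converse of \<open>?R\<close> is the same construction for
    \<open>S\<smile>\<close>, which yields the right-hand domains of \<open>?R\<close>.\<close>
  have conv: "?R\<smile> = K \<odot> S\<smile> \<odot> J"
    using Jd(3,4) Kd(3,4) coreflexive_conv[OF Jd(1)] coreflexive_conv[OF Kd(1)] by simp
  note left = ldom_index_seq[OF J K] lper_index_seq[OF J K]
  have right: "rdom \<A> ?R = K" "rper \<A> ?R = K"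
    using ldom_index_seq[OF K' J'] lper_index_seq[OF K' J']
    by (simp_all only: flip: conv ldom_conv lper_conv_eq_rper)
  have "thins_per \<A> (rper \<A> ?R) (rper \<A> S)"
    using thins_per_index[OF K' J'] by (simp only: lper_conv_eq_rper flip: conv)
  moreover have "?R = ldom \<A> ?R \<odot> S \<odot> rdom \<A> ?R"
    by (simp only: left right)
  moreover have "src \<A> ?R = src \<A> S" "tgt \<A> ?R = tgt \<A> S"
    using Jd(3,4) Kd(3,4) by simp_all
  ultimately have "thins \<A> ?R S"
    using thins_per_index[OF J K] unfolding thins_def by blast
  then have "?R = S"
    using min by (simp add: thins_minimal_def)
  then show ?thesis
    using left right by (simp add: core_relation_def)
qed

end

theorem theorem64:
  fixes \<A> :: "('t, 'r) relation_algebra_ops" and S :: 'r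
  assumes "point_free_relation_algebra \<A>"
    and "axiom_of_choice \<A>"
  shows "thins_minimal \<A> S \<longleftrightarrow> core_relation \<A> S"
  using point_free_relation_algebra.core_if_thins_minimal[OF assms]
    point_free_relation_algebra.thins_minimal_if_core[OF assms(1)] by blast

end
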